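(* Let $u$ be a positive definite moment functional on $\Pi^d$, let $\lambda\in\mathbb{R}\setminus\{0\}$ and $c\in\mathbb{R}^d$, and suppose that the moment functional $v$ given by $\langle v,p\rangle=\langle u,p\rangle+\lambda\,p(c)$, $p\in\Pi^d$, is quasi definite (equivalently, $\lambda_n:=1+\lambda\,\mathbf{K}_n(c,c)\ne0$ for all $n\ge0$). Let $\mathbf{P}_k,\mathbf{K}_n$ be the reproducing kernels associated with $u$, let $\widetilde{\mathbf{P}}_k,\widetilde{\mathbf{K}}_n$ be the reproducing kernels associated with $v$, and put $\mathbf{K}_{-1}:=0$, $\lambda_{-1}:=1$. Then, for $k\ge0$, $$\widetilde{\mathbf{P}}_k(x,y)=\mathbf{P}_k(x,y)-\frac{\lambda}{\lambda_k}\,\mathbf{K}_k(x,c)\,\mathbf{K}_k(c,y)+\frac{\lambda}{\lambda_{k-1}}\,\mathbf{K}_{k-1}(x,c)\,\mathbf{K}_{k-1}(c,y).$$ Furthermore, for $n\ge0$, $$\widetilde{\mathbf{K}}_n(x,y)=\mathbf{K}_n(x,y)-\frac{\lambda}{\lambda_n}\,\mathbf{K}_n(x,c)\,\mathbf{K}_n(c,y).$$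
   Context: $\Pi^d$ is the space of real polynomials in $d$ variables, and $\Pi_n^d$ is the subspace of polynomials of total degree at most $n$. Write $r_n^d=\binom{n+d-1}{n}$. A moment functional is a real linear functional on $\Pi^d$, applied entrywise to matrices of polynomials. It is positive definite if $\langle u,p^2\rangle>0$ for all non-zero $p\in\Pi^d$. A sequence of orthogonal polynomials with respect to a moment functional $w$ is a sequence $\{\mathbb{P}_n\}_{n\ge0}$, where $\mathbb{P}_n$ is a column vector of $r_n^d$ polynomials in $\Pi_n^d$, with $\langle w,\mathbb{P}_n\mathbb{P}_m^T\rangle=H_n\delta_{m,n}$ and each $H_n$ invertible; $w$ is quasi definite if such a sequence exists (positive definite functionals are quasi definite). For a sequence $\{\mathbb{P}_n\}$ orthogonal with respect to $u$ with matrices $H_n$: $\mathbf{P}_k(x,y)=\mathbb{P}_k^T(x)H_k^{-1}\mathbb{P}_k(y)$ and $\mathbf{K}_n(x,y)=\sum_{k=0}^n\mathbf{P}_k(x,y)$. For a sequence $\{\mathbb{Q}_n\}$ orthogonal with respect to $v$, with $\widetilde H_k=\langle v,\mathbb{Q}_k\mathbb{Q}_k^T\rangle$: $\widetilde{\mathbf{P}}_k(x,y)=\mathbb{Q}_k^T(x)\widetilde H_k^{-1}\mathbb{Q}_k(y)$ and $\widetilde{\mathbf{K}}_n(x,y)=\sum_{k=0}^n\widetilde{\mathbf{P}}_k(x,y)$. These kernels do not depend on the choice of the sequences; one may take $\mathbb{Q}_n(x)=\mathbb{P}_n(x)-\frac{\lambda}{\lambda_{n-1}}\mathbf{K}_{n-1}(c,x)\mathbb{P}_n(c)$.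 *)

theory Defs
  imports
    "HOL-Analysis.Analysis"
    "HOL-Library.Poly_Mapping"
    "Jordan_Normal_Form.Gauss_Jordan_Elimination"
begin

no_notation Finite_Cartesian_Product.vec_nth (infixl "$" 90)

text \<open>
  The index type \<open>'d\<close> carries the \<open>d\<close> variables, so \<open>d = CARD('d) \<ge> 1\<close>, and points are
  elements of \<open>real^'d\<close>. Vectors and matrices whose size depends on the degree are those of
  \<open>Jordan_Normal_Form\<close>; the symbol \<open>$\<close> refers to their entries.
\<close>

type_synonym 'd poly_d = "('d \<Rightarrow>\<^sub>0 nat) \<Rightarrow>\<^sub>0 real"

definition scale_poly :: "real \<Rightarrow> 'd poly_d \<Rightarrow> 'd poly_d" where
  "scale_poly a p = Poly_Mapping.single 0 a * p"

definition eval_poly :: "('d::finite) poly_d \<Rightarrow> real^'d \<Rightarrow> real" where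
  "eval_poly p x =
     (\<Sum>m\<in>Poly_Mapping.keys p. Poly_Mapping.lookup p m *
        (\<Prod>i\<in>UNIV. vec_nth x i ^ Poly_Mapping.lookup m i))"

definition mono_degree :: "('d::finite \<Rightarrow>\<^sub>0 nat) \<Rightarrow> nat" where
  "mono_degree m = (\<Sum>i\<in>UNIV. Poly_Mapping.lookup m i)"

definition polys_upto :: "nat \<Rightarrow> ('d::finite) poly_d set" where
  "polys_upto n = {p. \<forall>m\<in>Poly_Mapping.keys p. mono_degree m \<le> n}"

definition rdim :: "nat \<Rightarrow> nat \<Rightarrow> nat" where
  "rdim d n = (n + d - 1) choose n"

interpretation poly_d: vector_space "scale_poly :: real \<Rightarrow> 'd poly_d \<Rightarrow> 'd poly_d"
  by unfold_locales
    (simp_all add: scale_poly_def algebra_simps single_add mult_single flip: mult.assoc)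

definition moment_functional :: "('d poly_d \<Rightarrow> real) \<Rightarrow> bool" where
  "moment_functional w \<longleftrightarrow> Vector_Spaces.linear scale_poly (*) w"

definition positive_definite :: "('d poly_d \<Rightarrow> real) \<Rightarrow> bool" where
  "positive_definite w \<longleftrightarrow> (\<forall>p. p \<noteq> 0 \<longrightarrow> w (p\<^sup>2) > 0)"

text \<open>The matrix \<open>\<langle>w, p q\<^sup>T\<rangle>\<close> for column vectors \<open>p\<close>, \<open>q\<close> of polynomials.\<close>

definition moment_matrix ::
    "('d poly_d \<Rightarrow> real) \<Rightarrow> 'd poly_d Matrix.vec \<Rightarrow> 'd poly_d Matrix.vec \<Rightarrow> real Matrix.mat" where
  "moment_matrix w p q =
     map_mat w (Matrix.mat (dim_vec p) (dim_vec q) (\<lambda>(i, j). p $ i * q $ j))"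

definition orthogonal_seq ::
    "(('d::finite) poly_d \<Rightarrow> real) \<Rightarrow> (nat \<Rightarrow> 'd poly_d Matrix.vec) \<Rightarrow> bool" where
  "orthogonal_seq w P \<longleftrightarrow>
     (\<forall>n. P n \<in> carrier_vec (rdim CARD('d) n) \<and> set\<^sub>v (P n) \<subseteq> polys_upto n) \<and>
     (\<forall>n m. n \<noteq> m \<longrightarrow>
        moment_matrix w (P n) (P m) = 0\<^sub>m (rdim CARD('d) n) (rdim CARD('d) m)) \<and>
     (\<forall>n. invertible_mat (moment_matrix w (P n) (P n)))"

definition quasi_definite :: "(('d::finite) poly_d \<Rightarrow> real) \<Rightarrow> bool" where
  "quasi_definite w \<longleftrightarrow> (\<exists>P. orthogonal_seq w P)"

definition eval_vec :: "('d::finite) poly_d Matrix.vec \<Rightarrow> real^'d \<Rightarrow> real Matrix.vec" where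
  "eval_vec p x = map_vec (\<lambda>q. eval_poly q x) p"

text \<open>\<open>P_k(x)\<^sup>T H_k\<^sup>-\<^sup>1 P_k(y)\<close> with \<open>H_k = \<langle>w, P_k P_k\<^sup>T\<rangle>\<close>; for an orthogonal sequence \<open>H_k\<close> is
  invertible, so that \<open>mat_inverse\<close> returns \<open>Some\<close> of its inverse.\<close>

definition kernelP ::
    "(('d::finite) poly_d \<Rightarrow> real) \<Rightarrow> (nat \<Rightarrow> 'd poly_d Matrix.vec) \<Rightarrow> nat \<Rightarrow>
     real^'d \<Rightarrow> real^'d \<Rightarrow> real" where
  "kernelP w P k x y =
     eval_vec (P k) x \<bullet>
       (the (mat_inverse (moment_matrix w (P k) (P k))) *\<^sub>v eval_vec (P k) y)"

text \<open>The index is an integer so that \<open>K_{-1} = 0\<close>; accordingly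
  \<open>mass_const\<close>, the number \<open>\<lambda>_n = 1 + \<lambda> K_n(c, c)\<close>, is \<open>1\<close> at \<open>n = -1\<close>.\<close>

definition kernelK ::
    "(('d::finite) poly_d \<Rightarrow> real) \<Rightarrow> (nat \<Rightarrow> 'd poly_d Matrix.vec) \<Rightarrow> int \<Rightarrow>
     real^'d \<Rightarrow> real^'d \<Rightarrow> real" where
  "kernelK w P n x y = (if n < 0 then 0 else \<Sum>k\<le>nat n. kernelP w P k x y)"

definition mass_const ::
    "(('d::finite) poly_d \<Rightarrow> real) \<Rightarrow> (nat \<Rightarrow> 'd poly_d Matrix.vec) \<Rightarrow> real \<Rightarrow> real^'d \<Rightarrow>
     int \<Rightarrow> real" where
  "mass_const w P lam c n = 1 + lam * kernelK w P n c c"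

end

theory Submission
  imports Defs "Jordan_Normal_Form.Determinant"
begin

text \<open>
  A kernel is pinned down by its reproducing property. If \<open>P\<close> is orthogonal with respect to \<open>w\<close>,
  then \<open>K_n(x, \<cdot>)\<close> is, as a function on \<open>\<real>\<^sup>d\<close>, the only polynomial of degree at most \<open>n\<close> with
  \<open>w (K_n(x, \<cdot>) p) = p(x)\<close> for all \<open>p\<close> of degree at most \<open>n\<close>: this is \<open>kernel_reproduces\<close>, and
  uniqueness is \<open>orthogonal_below_vanishes\<close>, because a polynomial \<open>q\<close> of degree at most \<open>n\<close> that
  is orthogonal to all others satisfies \<open>q(x) = w (K_n(x, \<cdot>) q) = 0\<close>. The reproducing property
  is bilinear algebra once the entries of \<open>P_0, \<dots>, P_n\<close> are known to span the polynomials of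
  degree at most \<open>n\<close>. They are independent, because they possess a dual family, and they are as
  many as the monomials (\<open>polys_below_subset_span\<close>).

  For \<open>v = u + \<lambda> \<delta>_c\<close> and \<open>p\<close> of degree at most \<open>n\<close> one gets
  \<open>v (K_n(c, \<cdot>) p) = \<lambda>_n p(c)\<close> (\<open>v_kernel_c\<close>). Both directions rest on this identity.
  If \<open>\<lambda>_n = 0\<close>, then \<open>K_n(c, \<cdot>)\<close> is \<open>v\<close>-orthogonal to all polynomials of degree at most \<open>n\<close>; for
  quasi definite \<open>v\<close> it then vanishes at \<open>c\<close>, so \<open>\<lambda>_n = 1\<close>, a contradiction. If \<open>\<lambda>_n \<noteq> 0\<close>, then
  \<open>v (K_n(x, \<cdot>) p) = p(x) + \<lambda> K_n(x, c) p(c)\<close>, and the surplus is removed by subtracting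
  \<open>\<lambda>/\<lambda>_n K_n(x, c) K_n(c, \<cdot>)\<close>; by uniqueness this gives the kernel of \<open>v\<close>
  (\<open>kernel_perturbed\<close>). The formula for the summands \<open>P_k\<close> is the difference of two
  consecutive instances.

  For the converse, \<open>P_n\<close> is corrected by the multiple of \<open>K_{n-1}(c, \<cdot>)\<close> that makes it
  \<open>v\<close>-orthogonal to lower degrees. Its Gram matrix is \<open>H_n\<close> plus
  \<open>\<lambda>/\<lambda>_{n-1} P_n(c) P_n(c)\<^sup>T\<close>, which is invertible because the quantity that governs rank-one
  updates equals \<open>\<lambda>_n/\<lambda>_{n-1}\<close> here (\<open>invertible_rank_one_update\<close>).
\<close>

section \<open>Evaluation of polynomials\<close>

definition monomial_value :: "real^'d::finite \<Rightarrow> ('d \<Rightarrow>\<^sub>0 nat) \<Rightarrow> real" where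
  "monomial_value x m = (\<Prod>i\<in>UNIV. vec_nth x i ^ Poly_Mapping.lookup m i)"

lemma monomial_value_add: "monomial_value x (m + n) = monomial_value x m * monomial_value x n"
  by (simp add: monomial_value_def lookup_add power_add prod.distrib)

lemma eval_poly_superset:
  assumes "finite S" "Poly_Mapping.keys p \<subseteq> S"
  shows "eval_poly p x = (\<Sum>m\<in>S. Poly_Mapping.lookup p m * monomial_value x m)"
  unfolding eval_poly_def monomial_value_def
  by (rule sum.mono_neutral_left) (use assms in \<open>auto simp: in_keys_iff\<close>)

lemma eval_poly_add: "eval_poly (p + q) x = eval_poly p x + eval_poly q x"
proof -
  let ?S = "Poly_Mapping.keys p \<union> Poly_Mapping.keys q"
  have "Poly_Mapping.keys (p + q) \<subseteq> ?S" by (rule keys_add)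
  then show ?thesis
    by (simp add: eval_poly_superset[of ?S] lookup_add distrib_right sum.distrib)
qed

lemma eval_poly_0 [simp]: "eval_poly 0 x = 0"
  by (simp add: eval_poly_def)

lemma eval_poly_sum: "eval_poly (\<Sum>i\<in>I. f i) x = (\<Sum>i\<in>I. eval_poly (f i) x)"
  by (induction I rule: infinite_finite_induct) (simp_all add: eval_poly_add)

lemma eval_poly_single: "eval_poly (Poly_Mapping.single m a) x = a * monomial_value x m"
  by (simp add: eval_poly_superset[of "{m}"])

lemma poly_sum_singles:
  "p = (\<Sum>m\<in>Poly_Mapping.keys p. Poly_Mapping.single m (Poly_Mapping.lookup p m))"
proof (rule poly_mapping_eqI)
  fix k
  show "Poly_Mapping.lookup p k = Poly_Mapping.lookup
      (\<Sum>m\<in>Poly_Mapping.keys p. Poly_Mapping.single m (Poly_Mapping.lookup p m)) k"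
    by (simp add: lookup_sum lookup_single when_def in_keys_iff)
qed

lemma eval_poly_mult: "eval_poly (p * q) x = eval_poly p x * eval_poly q x"
proof -
  have "p * q = (\<Sum>m\<in>Poly_Mapping.keys p. \<Sum>n\<in>Poly_Mapping.keys q.
      Poly_Mapping.single (m + n) (Poly_Mapping.lookup p m * Poly_Mapping.lookup q n))"
    using arg_cong2[OF poly_sum_singles[of p] poly_sum_singles[of q], of "(*)"]
    by (simp add: sum_product mult_single)
  then have "eval_poly (p * q) x = (\<Sum>m\<in>Poly_Mapping.keys p. \<Sum>n\<in>Poly_Mapping.keys q.
      (Poly_Mapping.lookup p m * Poly_Mapping.lookup q n) *
      (monomial_value x m * monomial_value x n))"
    by (simp only: eval_poly_sum eval_poly_single monomial_value_add)
  then show ?thesis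
    by (simp add: eval_poly_superset[OF finite_keys subset_refl] sum_product mult_ac)
qed

lemma eval_poly_scale [simp]: "eval_poly (scale_poly a p) x = a * eval_poly p x"
  by (simp add: scale_poly_def eval_poly_mult eval_poly_single monomial_value_def)

lemma scale_poly_mult_left: "scale_poly a p * q = scale_poly a (p * q)"
  by (simp add: scale_poly_def mult.assoc)

section \<open>Moment functionals\<close>

lemma moment_functional_iff:
  "moment_functional w \<longleftrightarrow>
    (\<forall>p q. w (p + q) = w p + w q) \<and> (\<forall>a p. w (scale_poly a p) = a * w p)"
proof -
  have "vector_space ((*) :: real \<Rightarrow> real \<Rightarrow> real)"
    by unfold_locales (simp_all add: algebra_simps)
  then show ?thesis
    using poly_d.vector_space_axioms by (auto simp: moment_functional_def Vector_Spaces.linear_iff)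
qed

locale functional =
  fixes w :: "'d poly_d \<Rightarrow> real"
  assumes moment_functional: "moment_functional w"
begin

lemma add: "w (p + q) = w p + w q"
  and scale: "w (scale_poly a p) = a * w p"
  using moment_functional by (simp_all add: moment_functional_iff)

lemma zero [simp]: "w 0 = 0"
  using add[of 0 0] by simp

lemma diff: "w (p - q) = w p - w q"
  using add[of "p - q" q] by simp

lemma sum: "w (\<Sum>i\<in>I. f i) = (\<Sum>i\<in>I. w (f i))"
  by (induction I rule: infinite_finite_induct) (simp_all add: add)

lemma eq_on_span:
  assumes "functional w'" "\<And>p. p \<in> S \<Longrightarrow> w p = w' p" "p \<in> poly_d.span S"
  shows "w p = w' p"
proof -
  interpret w': functional w' by fact
  have "poly_d.subspace {p. w p = w' p}"
    by (rule poly_d.subspaceI) (auto simp: add scale w'.add w'.scale)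
  from poly_d.span_induct[OF assms(3) this] show ?thesis
    using assms(2) by auto
qed

end

lemma functional_zero: "functional (\<lambda>p. 0)"
  by (simp add: functional_def moment_functional_iff)

lemma functional_eval: "functional (\<lambda>p. eval_poly p x)"
  by (simp add: functional_def moment_functional_iff eval_poly_add)

context functional
begin

lemma diff_scale_mult_left: "w ((p - scale_poly t q) * s) = w (p * s) - t * w (q * s)"
  by (simp add: left_diff_distrib diff scale_poly_mult_left scale)

lemma diff_scale_mult_right: "w (s * (p - scale_poly t q)) = w (s * p) - t * w (s * q)"
  using diff_scale_mult_left[of p t q s] by (simp only: mult.commute[of s])

lemma functional_times: "functional (\<lambda>p. w (q * p))"
  by (simp add: functional_def moment_functional_iff distrib_right add scale
      scale_poly_mult_left mult.commute[of q])

end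

text \<open>A functional that is \<open>1\<close> on one member of the family and \<open>0\<close> on the others separates that
  member from the span of the others.\<close>

lemma biorthogonal_independent:
  assumes lin: "\<And>i. i \<in> I \<Longrightarrow> functional (\<phi> i)"
    and dual: "\<And>i j. i \<in> I \<Longrightarrow> j \<in> I \<Longrightarrow> \<phi> i (f j) = (if i = j then 1 else 0)"
  shows "inj_on f I" and "poly_d.independent (f ` I)"
proof -
  show inj: "inj_on f I"
  proof (rule inj_onI, rule ccontr)
    fix i j assume "i \<in> I" "j \<in> I" "f i = f j" "i \<noteq> j"
    then show False using dual[of i i] dual[of i j] by simp
  qed
  show "poly_d.independent (f ` I)"
  proof
    assume "poly_d.dependent (f ` I)"
    then obtain i where i: "i \<in> I" and "f i \<in> poly_d.span (f ` I - {f i})"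
      by (auto simp: poly_d.dependent_def)
    moreover have "\<phi> i q = 0" if "q \<in> f ` I - {f i}" for q
      using that i by (auto simp: dual)
    ultimately have "\<phi> i (f i) = 0"
      using functional.eq_on_span[OF lin[OF i] functional_zero] by blast
    then show False using dual[OF i i] by simp
  qed
qed

section \<open>Polynomials of bounded degree\<close>

text \<open>Listing the exponents of a monomial in a fixed order of the variables turns monomials of
  degree \<open>k\<close> into lists of length \<open>d\<close> with sum \<open>k\<close>.\<close>

lemma card_mono_degree_eq:
  "card {m :: 'd::finite \<Rightarrow>\<^sub>0 nat. mono_degree m = k} = rdim CARD('d) k"
proof -
  obtain xs :: "'d list" where xs: "set xs = UNIV" "distinct xs"
    using finite_distinct_list[OF finite_class.finite_UNIV] by blast
  then have len: "length xs = CARD('d)"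
    by (metis distinct_card)
  let ?F = "\<lambda>m. map (Poly_Mapping.lookup m) xs"
  have deg: "sum_list (?F m) = mono_degree m" for m :: "'d \<Rightarrow>\<^sub>0 nat"
    using xs by (simp add: mono_degree_def sum_list_distinct_conv_sum_set)
  have "bij_betw ?F {m. mono_degree m = k} {l. length l = CARD('d) \<and> sum_list l = k}"
    unfolding bij_betw_def
  proof (intro conjI inj_onI equalityI subsetI)
    fix m m' :: "'d \<Rightarrow>\<^sub>0 nat"
    assume "?F m = ?F m'"
    then show "m = m'" using xs by (intro poly_mapping_eqI) simp
  next
    fix l assume "l \<in> ?F ` {m. mono_degree m = k}"
    then show "l \<in> {l. length l = CARD('d) \<and> sum_list l = k}"
      using deg len by auto
  next
    fix l :: "nat list" assume l: "l \<in> {l. length l = CARD('d) \<and> sum_list l = k}"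
    define m where "m = Abs_poly_mapping (\<lambda>a. the (map_of (zip xs l) a))"
    have "Poly_Mapping.lookup m a = the (map_of (zip xs l) a)" for a
      unfolding m_def by (subst lookup_Abs_poly_mapping) auto
    then have "?F m = l"
      using l len xs by (intro nth_equalityI) (auto simp: map_of_zip_nth)
    moreover from this have "mono_degree m = k" using deg[of m] l by simp
    ultimately show "l \<in> ?F ` {m. mono_degree m = k}" by blast
  qed
  then show ?thesis
    by (simp add: bij_betw_same_card card_length_sum_list rdim_def)
qed

lemma finite_mono_degree_eq: "finite {m :: 'd::finite \<Rightarrow>\<^sub>0 nat. mono_degree m = k}"
proof (rule card_ge_0_finite)
  have "k \<le> k + CARD('d) - 1" using zero_less_card_finite[where 'a='d] by linarith
  then show "0 < card {m :: 'd \<Rightarrow>\<^sub>0 nat. mono_degree m = k}"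
    by (simp add: card_mono_degree_eq rdim_def)
qed

lemma mono_degree_less_UN:
  "{m. mono_degree m < n} = (\<Union>k<n. {m. mono_degree m = k})"
  by auto

lemma finite_mono_degree_less: "finite {m :: 'd::finite \<Rightarrow>\<^sub>0 nat. mono_degree m < n}"
  by (simp add: mono_degree_less_UN finite_mono_degree_eq)

lemma card_mono_degree_less:
  "card {m :: 'd::finite \<Rightarrow>\<^sub>0 nat. mono_degree m < n} = (\<Sum>k<n. rdim CARD('d) k)"
  unfolding mono_degree_less_UN
  by (subst card_UN_disjoint) (auto simp: finite_mono_degree_eq card_mono_degree_eq)

text \<open>With a strict bound, degree \<open>-1\<close> becomes \<open>n = 0\<close>, so that \<open>K_{-1} = 0\<close> is the kernel of the
  zero space and needs no separate treatment.\<close>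

definition polys_below :: "nat \<Rightarrow> ('d::finite) poly_d set" where
  "polys_below n = {p. \<forall>m\<in>Poly_Mapping.keys p. mono_degree m < n}"

lemma polys_upto_eq_below: "polys_upto n = polys_below (Suc n)"
  by (auto simp: polys_upto_def polys_below_def less_Suc_eq_le)

lemma polys_below_mono: "m \<le> n \<Longrightarrow> polys_below m \<subseteq> polys_below n"
  by (auto simp: polys_below_def)

lemma polys_below_span:
  "polys_below n = poly_d.span ((\<lambda>m. Poly_Mapping.single m 1) ` {m. mono_degree m < n})"
  (is "_ = poly_d.span ?M")
proof (intro equalityI subsetI)
  fix p :: "'a poly_d" assume p: "p \<in> polys_below n"
  have "(\<Sum>m\<in>Poly_Mapping.keys p. Poly_Mapping.single m (Poly_Mapping.lookup p m))
      \<in> poly_d.span ?M"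
  proof (rule poly_d.span_sum)
    fix m assume "m \<in> Poly_Mapping.keys p"
    then have "Poly_Mapping.single m (1::real) \<in> ?M" using p by (auto simp: polys_below_def)
    from poly_d.span_scale[OF poly_d.span_base[OF this], of "Poly_Mapping.lookup p m"]
    show "Poly_Mapping.single m (Poly_Mapping.lookup p m) \<in> poly_d.span ?M"
      by (simp add: scale_poly_def mult_single)
  qed
  then show "p \<in> poly_d.span ?M" using poly_sum_singles[of p] by simp
next
  fix p :: "'a poly_d" assume p: "p \<in> poly_d.span ?M"
  have "poly_d.subspace (polys_below n :: 'a poly_d set)"
  proof (rule poly_d.subspaceI)
    fix p q :: "'a poly_d" assume "p \<in> polys_below n" "q \<in> polys_below n"
    then show "p + q \<in> polys_below n"
      using keys_add[of p q] by (auto simp: polys_below_def)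
  next
    fix a :: real and p :: "'a poly_d" assume "p \<in> polys_below n"
    moreover have "Poly_Mapping.keys (scale_poly a p) \<subseteq> Poly_Mapping.keys p"
      unfolding scale_poly_def
      using keys_mult[of "Poly_Mapping.single 0 a" p] by (auto split: if_splits)
    ultimately show "scale_poly a p \<in> polys_below n" by (auto simp: polys_below_def)
  qed (simp add: polys_below_def)
  moreover have "?M \<subseteq> polys_below n" by (auto simp: polys_below_def)
  ultimately show "p \<in> polys_below n" using p poly_d.span_minimal by blast
qed

lemma subspace_polys_below: "poly_d.subspace (polys_below n)"
  by (simp add: polys_below_span)

text \<open>The monomials span, so no independent set of polynomials of degree below \<open>n\<close> is larger than
  their number; one of exactly that size admits no independent extension.\<close>

lemma span_of_independent_card:
  fixes S :: "('d::finite) poly_d set"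
  assumes "S \<subseteq> polys_below n" "poly_d.independent S" "card S = (\<Sum>k<n. rdim CARD('d) k)"
  shows "polys_below n \<subseteq> poly_d.span S"
proof
  fix p :: "'d poly_d" assume p: "p \<in> polys_below n"
  let ?M = "(\<lambda>m. Poly_Mapping.single m 1) ` {m. mono_degree m < n} :: 'd poly_d set"
  have M: "finite ?M" "card ?M = card S"
    using finite_mono_degree_less[where 'd='d and n=n]
    by (auto simp: assms(3) card_mono_degree_less[symmetric] intro!: card_image inj_onI
        dest!: arg_cong[of _ _ Poly_Mapping.keys])
  have S: "finite S"
    using poly_d.independent_span_bound[OF M(1) assms(2)] assms(1) by (simp add: polys_below_span)
  show "p \<in> poly_d.span S"
  proof (rule ccontr)
    assume np: "p \<notin> poly_d.span S"
    then have "poly_d.independent (insert p S)"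
      using assms(2) by (rule poly_d.independent_insertI)
    moreover have "insert p S \<subseteq> poly_d.span ?M"
      using p assms(1) by (simp add: polys_below_span)
    ultimately have "card (insert p S) \<le> card ?M"
      using poly_d.independent_span_bound[OF M(1)] by blast
    moreover have "p \<notin> S" using np poly_d.span_base by blast
    ultimately show False using S M(2) by simp
  qed
qed


section \<open>Reproducing kernels of an orthogonal sequence\<close>

locale orthogonal_system = functional w
  for w :: "('d::finite) poly_d \<Rightarrow> real" +
  fixes P :: "nat \<Rightarrow> 'd poly_d Matrix.vec"
  assumes orthogonal: "orthogonal_seq w P"
begin

abbreviation "r k \<equiv> dim_vec (P k)"
abbreviation "H k \<equiv> moment_matrix w (P k) (P k)"
abbreviation "G k \<equiv> the (mat_inverse (H k))"

lemma dim_P: "r k = rdim CARD('d) k"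
  using orthogonal by (simp add: orthogonal_seq_def)

lemma P_below: "i < r k \<Longrightarrow> P k $ i \<in> polys_below (Suc k)"
  using orthogonal by (auto simp: orthogonal_seq_def polys_upto_eq_below vec_set_def)

lemma H_carrier: "H k \<in> carrier_mat (r k) (r k)"
  by (simp add: moment_matrix_def)

lemma H_index: "i < r k \<Longrightarrow> j < r k \<Longrightarrow> H k $$ (i, j) = w (P k $ i * P k $ j)"
  by (simp add: moment_matrix_def)

lemma P_orthogonal:
  assumes "k \<noteq> m" "i < r k" "j < r m"
  shows "w (P k $ i * P m $ j) = 0"
proof -
  have "moment_matrix w (P k) (P m) $$ (i, j) = 0"
    using orthogonal assms by (simp add: orthogonal_seq_def dim_P)
  then show ?thesis using assms by (simp add: moment_matrix_def)
qed

lemma G_inverse: "G k * H k = 1\<^sub>m (r k)" "G k \<in> carrier_mat (r k) (r k)"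
proof -
  have "invertible_mat (H k)" using orthogonal by (simp add: orthogonal_seq_def)
  then obtain B where B: "H k * B = 1\<^sub>m (r k)" "B * H k = 1\<^sub>m (dim_row B)"
    using H_carrier[of k] by (auto simp: invertible_mat_def inverts_mat_def)
  have "dim_col (H k * B) = r k" "dim_col (B * H k) = dim_row B"
    using B by simp_all
  then have "B \<in> carrier_mat (r k) (r k)" using H_carrier[of k] by auto
  with B H_carrier[of k] have "H k \<in> Units (ring_mat TYPE(real) (r k) ())"
    by (auto simp: Units_def ring_mat_def)
  then obtain B' where "mat_inverse (H k) = Some B'"
    using mat_inverse(1)[OF H_carrier[of k]] by fastforce
  from mat_inverse(2)[OF H_carrier this] this
  show "G k * H k = 1\<^sub>m (r k)" "G k \<in> carrier_mat (r k) (r k)" by simp_all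
qed

text \<open>The family dual to the entries of \<open>P\<close>. Since the kernel summand is
  \<open>P_k(x)\<^sup>T H_k\<^sup>-\<^sup>1 P_k(y)\<close>, it equals \<open>\<Sum>\<^sub>i P_k,i(x) dual_k,i(y)\<close>.\<close>

definition dual :: "nat \<Rightarrow> nat \<Rightarrow> 'd poly_d" where
  "dual k i = (\<Sum>j<r k. scale_poly (G k $$ (i, j)) (P k $ j))"

lemma dual_below:
  assumes "k < n" "i < r k"
  shows "dual k i \<in> polys_below n"
proof -
  have "P k $ j \<in> polys_below n" if "j < r k" for j
    using P_below[OF that] polys_below_mono[of "Suc k" n] assms(1) by auto
  then show ?thesis unfolding dual_def
    by (intro poly_d.subspace_sum poly_d.subspace_scale subspace_polys_below) auto
qed

lemma dual_P:
  assumes "i < r k" "j < r m"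
  shows "w (dual k i * P m $ j) = (if (k, i) = (m, j) then 1 else 0)"
proof -
  have "w (dual k i * P m $ j) = (\<Sum>l<r k. G k $$ (i, l) * w (P k $ l * P m $ j))"
    by (simp add: dual_def sum_distrib_right scale_poly_mult_left sum scale)
  also have "\<dots> = (if (k, i) = (m, j) then 1 else 0)"
  proof (cases "k = m")
    case True
    have "(\<Sum>l<r k. G k $$ (i, l) * w (P k $ l * P k $ j)) = (G k * H k) $$ (i, j)"
      using assms G_inverse(2)[of k] H_carrier[of k] True
      by (auto simp: scalar_prod_def H_index lessThan_atLeast0 intro!: sum.cong)
    then show ?thesis using assms True G_inverse(1)[of k] by simp
  next
    case False
    then show ?thesis using assms by (simp add: P_orthogonal)
  qed
  finally show ?thesis .
qed

text \<open>Biorthogonality to the dual family makes the entries independent, and \<open>rdim\<close> is such that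
  there are as many of them as monomials.\<close>

lemma polys_below_subset_span:
  "polys_below n \<subseteq> poly_d.span {P k $ i | k i. k < n \<and> i < r k}"
proof -
  let ?I = "SIGMA k:{..<n}. {..<r k}" and ?f = "\<lambda>(k, i). P k $ i"
  have eq: "{P k $ i | k i. k < n \<and> i < r k} = ?f ` ?I"
    by (auto simp: image_iff)
  let ?\<phi> = "\<lambda>(k, i) p. w (dual k i * p)"
  have "functional (?\<phi> a)" for a
    by (cases a) (simp add: functional_times)
  moreover have "?\<phi> a (?f b) = (if a = b then 1 else 0)" if "a \<in> ?I" "b \<in> ?I" for a b
    using that by (cases a; cases b) (simp add: dual_P)
  ultimately have *: "inj_on ?f ?I" "poly_d.independent (?f ` ?I)"
    using biorthogonal_independent[of ?I ?\<phi> ?f] by blast+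
  have "?f ` ?I \<subseteq> polys_below n"
  proof (clarsimp)
    fix k i assume "k < n" "i < r k"
    then show "P k $ i \<in> polys_below n"
      using P_below[of i k] polys_below_mono[of "Suc k" n] by auto
  qed
  moreover have "card (?f ` ?I) = (\<Sum>k<n. r k)"
    using *(1) by (simp add: card_image)
  ultimately show ?thesis
    unfolding eq using *(2) by (intro span_of_independent_card) (simp_all add: dim_P)
qed

text \<open>This is \<open>K_{n-1}(x, \<cdot>)\<close> as a polynomial in the second argument. Keeping only \<open>x\<close> evaluated
  allows \<open>w\<close> to be applied to it.\<close>

definition kernel :: "nat \<Rightarrow> real^'d \<Rightarrow> 'd poly_d" where
  "kernel n x = (\<Sum>k<n. \<Sum>i<r k. scale_poly (eval_poly (P k $ i) x) (dual k i))"

lemma kernel_below: "kernel n x \<in> polys_below n"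
  unfolding kernel_def
  by (intro poly_d.subspace_sum poly_d.subspace_scale subspace_polys_below dual_below) auto

lemma kernel_P:
  assumes "j < r m"
  shows "w (kernel n x * P m $ j) = (if m < n then eval_poly (P m $ j) x else 0)"
proof -
  have "w (kernel n x * P m $ j) =
      (\<Sum>k<n. \<Sum>i<r k. if i = j \<and> k = m then eval_poly (P k $ i) x else 0)"
    unfolding kernel_def sum_distrib_right scale_poly_mult_left sum scale
    by (intro sum.cong refl) (auto simp: dual_P assms)
  also have "\<dots> = (\<Sum>k<n. if k = m then eval_poly (P m $ j) x else 0)"
    using assms by (intro sum.cong refl) (auto intro: sum.neutral)
  finally show ?thesis by simp
qed

text \<open>Both sides are linear in \<open>p\<close>, so it suffices to compare them on the entries of \<open>P\<close>.\<close>

lemma kernel_reproduces: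
  assumes "p \<in> polys_below n"
  shows "w (kernel n x * p) = eval_poly p x"
proof -
  have p: "p \<in> poly_d.span {P k $ i | k i. k < n \<and> i < r k}"
    using assms polys_below_subset_span by blast
  show ?thesis
    by (rule functional.eq_on_span[OF functional_times functional_eval _ p])
      (auto simp: kernel_P)
qed

lemma P_orthogonal_below:
  assumes "i < r n" "p \<in> polys_below n"
  shows "w (P n $ i * p) = 0"
proof -
  have p: "p \<in> poly_d.span {P k $ i | k i. k < n \<and> i < r k}"
    using assms polys_below_subset_span by blast
  show ?thesis
    by (rule functional.eq_on_span[OF functional_times functional_zero _ p])
      (use assms in \<open>auto simp: P_orthogonal\<close>)
qed

text \<open>Testing \<open>q\<close> against the reproducing kernel recovers its value at \<open>x\<close>. Applied
  to a difference of two reproducing kernels, it shows that they agree at every point.\<close>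

lemma orthogonal_below_vanishes:
  assumes "q \<in> polys_below n" "\<And>p. p \<in> polys_below n \<Longrightarrow> w (q * p) = 0"
  shows "eval_poly q x = 0"
  using assms(2)[OF kernel_below[of n x]] kernel_reproduces[OF assms(1), of x]
  by (simp add: mult.commute)

lemma kernelP_eq:
  "kernelP w P k x y = (\<Sum>i<r k. eval_poly (P k $ i) x * eval_poly (dual k i) y)"
  unfolding kernelP_def eval_vec_def dual_def
  using G_inverse(2)[of k]
  by (auto simp: scalar_prod_def eval_poly_sum lessThan_atLeast0 intro!: sum.cong)

lemma kernelK_eq: "kernelK w P (int n - 1) x y = eval_poly (kernel n x) y"
proof (cases n)
  case 0
  then show ?thesis by (simp add: kernelK_def kernel_def)
next
  case (Suc m)
  then show ?thesis
    by (simp add: kernelK_def kernel_def eval_poly_sum kernelP_eq lessThan_Suc_atMost)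
qed

lemma kernelP_eq_diff:
  "kernelP w P k x y = eval_poly (kernel (Suc k) x) y - eval_poly (kernel k x) y"
  by (simp add: kernel_def kernelP_eq eval_poly_add eval_poly_sum)

lemma kernel_Suc_diag:
  "eval_poly (kernel (Suc k) x) x =
    eval_poly (kernel k x) x + eval_vec (P k) x \<bullet> (G k *\<^sub>v eval_vec (P k) x)"
  using kernelP_eq_diff[of k x x] by (simp add: kernelP_def)

end

section \<open>Rank-one updates of matrices\<close>

lemma invertible_mat_if_det_nonzero:
  fixes A :: "real Matrix.mat"
  assumes "A \<in> carrier_mat n n" "Determinant.det A \<noteq> 0"
  shows "invertible_mat A"
  using det_non_zero_imp_unit[OF assms, of "()"] assms(1)
  by (auto simp: Units_def ring_mat_def invertible_mat_def inverts_mat_def)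

text \<open>If \<open>(A + \<mu> a a\<^sup>T) z = 0\<close>, then \<open>z = - \<mu> (a\<^sup>T z) G a\<close> with \<open>G\<close> the inverse of \<open>A\<close>. Pairing
  with \<open>a\<close> gives \<open>(1 + \<mu> a\<^sup>T G a) (a\<^sup>T z) = 0\<close>, hence \<open>a\<^sup>T z = 0\<close> and \<open>z = 0\<close>.\<close>

lemma invertible_rank_one_update:
  fixes A :: "real Matrix.mat"
  assumes A: "A \<in> carrier_mat n n" and G: "G \<in> carrier_mat n n" "G * A = 1\<^sub>m n"
    and a: "a \<in> carrier_vec n" and nz: "1 + \<mu> * (a \<bullet> (G *\<^sub>v a)) \<noteq> 0"
    and B: "B \<in> carrier_mat n n"
      "\<And>i j. i < n \<Longrightarrow> j < n \<Longrightarrow> B $$ (i, j) = A $$ (i, j) + \<mu> * a $ i * a $ j"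
  shows "invertible_mat B"
proof (rule ccontr)
  assume "\<not> invertible_mat B"
  then have "Determinant.det B = 0" using B invertible_mat_if_det_nonzero by blast
  then obtain z where z: "z \<in> carrier_vec n" "z \<noteq> 0\<^sub>v n" "B *\<^sub>v z = 0\<^sub>v n"
    using det_0_iff_vec_prod_zero_field[OF B(1)] by blast
  have Az: "A *\<^sub>v z = (- \<mu> * (a \<bullet> z)) \<cdot>\<^sub>v a"
  proof (rule eq_vecI)
    fix i assume "i < dim_vec ((- \<mu> * (a \<bullet> z)) \<cdot>\<^sub>v a)"
    then have i: "i < n" using a by simp
    have "0 = (B *\<^sub>v z) $ i" using z i by simp
    also have "\<dots> = (\<Sum>j<n. (A $$ (i, j) + \<mu> * a $ i * a $ j) * z $ j)"
      using B z(1) i by (auto simp: scalar_prod_def lessThan_atLeast0 intro!: sum.cong)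
    also have "\<dots> = (A *\<^sub>v z) $ i + \<mu> * a $ i * (a \<bullet> z)"
      using A a z i by (simp add: scalar_prod_def lessThan_atLeast0 sum.distrib
          distrib_right sum_distrib_left mult.assoc)
    finally show "(A *\<^sub>v z) $ i = ((- \<mu> * (a \<bullet> z)) \<cdot>\<^sub>v a) $ i"
      using a i by (simp add: mult_ac)
  qed (use A a in auto)
  have "z = (G * A) *\<^sub>v z" using G z by simp
  also have "\<dots> = G *\<^sub>v (A *\<^sub>v z)" using A G z by (intro assoc_mult_mat_vec)
  also have "\<dots> = (- \<mu> * (a \<bullet> z)) \<cdot>\<^sub>v (G *\<^sub>v a)"
    unfolding Az using G a by (intro mult_mat_vec)
  finally have zeq: "z = (- \<mu> * (a \<bullet> z)) \<cdot>\<^sub>v (G *\<^sub>v a)" .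
  have "a \<bullet> z = (- \<mu> * (a \<bullet> z)) * (a \<bullet> (G *\<^sub>v a))"
    by (subst zeq, rule scalar_prod_smult_right) (use G a in auto)
  then have "(1 + \<mu> * (a \<bullet> (G *\<^sub>v a))) * (a \<bullet> z) = 0" by (simp add: algebra_simps)
  then have "a \<bullet> z = 0" using nz by simp
  with zeq have "z = 0 \<cdot>\<^sub>v (G *\<^sub>v a)" by simp
  then have "z = 0\<^sub>v n" using G by auto
  with z show False by simp
qed

section \<open>Adding a point mass\<close>

locale point_mass = u: orthogonal_system u P
  for u :: "('d::finite) poly_d \<Rightarrow> real" and P :: "nat \<Rightarrow> 'd poly_d Matrix.vec" +
  fixes v :: "'d poly_d \<Rightarrow> real" and lam :: real and c :: "real^'d"
  assumes v_eq: "v p = u p + lam * eval_poly p c"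
begin

text \<open>Following the index of \<open>kernel\<close>, \<open>\<Lambda> n\<close> is \<open>\<lambda>_{n-1}\<close>, which includes \<open>\<lambda>_{-1} = 1\<close>.\<close>

definition \<Lambda> :: "nat \<Rightarrow> real" where
  "\<Lambda> n = 1 + lam * eval_poly (u.kernel n c) c"

lemma mass_const_eq: "mass_const u P lam c (int n - 1) = \<Lambda> n"
  by (simp add: mass_const_def \<Lambda>_def u.kernelK_eq)

lemma \<Lambda>_0: "\<Lambda> 0 = 1"
  by (simp add: \<Lambda>_def u.kernel_def)

sublocale v: functional v
  by unfold_locales
    (simp add: moment_functional_iff v_eq u.add u.scale eval_poly_add algebra_simps)

text \<open>For \<open>v\<close>, the kernel at the mass point reproduces the value at \<open>c\<close> up to the factor \<open>\<Lambda> n\<close>: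
  \<open>u\<close> contributes \<open>p(c)\<close> and the mass contributes \<open>\<lambda> K_{n-1}(c, c) p(c)\<close>.\<close>

lemma v_kernel_c:
  assumes "p \<in> polys_below n"
  shows "v (u.kernel n c * p) = \<Lambda> n * eval_poly p c"
  using assms by (simp add: v_eq u.kernel_reproduces eval_poly_mult \<Lambda>_def distrib_right mult.assoc)

text \<open>Otherwise \<open>K_{n-1}(c, \<cdot>)\<close> is \<open>v\<close>-orthogonal to its whole degree range, hence vanishes at
  \<open>c\<close>, which forces \<open>\<Lambda> n = 1\<close>.\<close>

lemma \<Lambda>_nonzero:
  assumes "orthogonal_seq v Q"
  shows "\<Lambda> n \<noteq> 0"
proof
  interpret Q: orthogonal_system v Q by unfold_locales fact
  assume 0: "\<Lambda> n = 0"
  have "eval_poly (u.kernel n c) c = 0"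
    by (rule Q.orthogonal_below_vanishes[OF u.kernel_below]) (simp add: v_kernel_c 0)
  then show False using 0 by (simp add: \<Lambda>_def)
qed

text \<open>The right-hand side has the reproducing property for \<open>v\<close>, which characterizes the kernel.\<close>

lemma kernel_perturbed:
  assumes "orthogonal_seq v Q"
  shows "eval_poly (orthogonal_system.kernel v Q n x) y =
    eval_poly (u.kernel n x) y
      - lam / \<Lambda> n * eval_poly (u.kernel n x) c * eval_poly (u.kernel n c) y"
proof -
  interpret Q: orthogonal_system v Q by unfold_locales fact
  define t where "t = lam / \<Lambda> n * eval_poly (u.kernel n x) c"
  define q where "q = u.kernel n x - scale_poly t (u.kernel n c)"
  have tL: "t * \<Lambda> n = lam * eval_poly (u.kernel n x) c"
    using \<Lambda>_nonzero[OF assms] by (simp add: t_def)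
  have q: "q \<in> polys_below n"
    unfolding q_def
    by (intro poly_d.subspace_diff poly_d.subspace_scale subspace_polys_below u.kernel_below)
  have "v (q * p) = eval_poly p x" if "p \<in> polys_below n" for p
  proof -
    have "v (q * p) = v (u.kernel n x * p) - (t * \<Lambda> n) * eval_poly p c"
      by (simp add: q_def v.diff_scale_mult_left v_kernel_c that)
    also have "\<dots> = eval_poly p x"
      unfolding tL v_eq using that by (simp add: u.kernel_reproduces eval_poly_mult)
    finally show ?thesis .
  qed
  then have "v ((Q.kernel n x - q) * p) = 0" if "p \<in> polys_below n" for p
    using that by (simp add: left_diff_distrib v.diff Q.kernel_reproduces)
  moreover have "Q.kernel n x - q \<in> polys_below n"
    by (intro poly_d.subspace_diff subspace_polys_below Q.kernel_below q)
  ultimately have "eval_poly (Q.kernel n x - q) y = 0"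
    by (rule Q.orthogonal_below_vanishes[rotated])
  then have "eval_poly (Q.kernel n x) y = eval_poly q y"
    using functional.diff[OF functional_eval, of "Q.kernel n x" q y] by simp
  then show ?thesis
    using functional.diff[OF functional_eval, of "u.kernel n x" "scale_poly t (u.kernel n c)" y]
    by (simp add: q_def t_def)
qed

text \<open>For \<open>p\<close> of lower degree, \<open>v (P_n p) = \<lambda> P_n(c) p(c)\<close>. By \<open>v_kernel_c\<close>, this is
  cancelled by the multiple \<open>\<lambda>/\<lambda>_{n-1} P_n(c)\<close> of \<open>K_{n-1}(c, \<cdot>)\<close>.\<close>

definition Q :: "nat \<Rightarrow> 'd poly_d Matrix.vec" where
  "Q n = Matrix.vec (u.r n) (\<lambda>i. P n $ i
     - scale_poly (lam / \<Lambda> n * eval_poly (P n $ i) c) (u.kernel n c))"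

lemma dim_Q [simp]: "dim_vec (Q n) = u.r n"
  by (simp add: Q_def)

lemma Q_below: "i < u.r n \<Longrightarrow> Q n $ i \<in> polys_below (Suc n)"
  unfolding Q_def using u.kernel_below[of n c] polys_below_mono[of n "Suc n"]
  by (auto intro!: poly_d.subspace_diff poly_d.subspace_scale subspace_polys_below u.P_below)

lemma Q_orthogonal_below:
  assumes "\<Lambda> n \<noteq> 0" "i < u.r n" "p \<in> polys_below n"
  shows "v (Q n $ i * p) = 0"
proof -
  have "v (Q n $ i * p) = v (P n $ i * p) - lam * eval_poly (P n $ i) c * eval_poly p c"
    using assms by (simp add: Q_def v.diff_scale_mult_left v_kernel_c)
  then show ?thesis
    using assms by (simp add: v_eq u.P_orthogonal_below eval_poly_mult)
qed

text \<open>The second factor may be replaced by \<open>P_n,j\<close>, because the correction term has lower degree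
  and is \<open>v\<close>-orthogonal to the first factor.\<close>

lemma Q_norm:
  assumes "\<Lambda> n \<noteq> 0" "i < u.r n" "j < u.r n"
  shows "v (Q n $ i * Q n $ j) =
    u (P n $ i * P n $ j) + lam / \<Lambda> n * eval_poly (P n $ i) c * eval_poly (P n $ j) c"
proof -
  let ?K = "u.kernel n c" and ?p = "eval_poly (P n $ i) c" and ?q = "eval_poly (P n $ j) c"
  have "v (Q n $ i * Q n $ j) = v (Q n $ i * P n $ j) - lam / \<Lambda> n * ?q * v (Q n $ i * ?K)"
    using assms(3) by (subst (2) Q_def) (simp add: v.diff_scale_mult_right)
  also have "v (Q n $ i * ?K) = 0"
    by (rule Q_orthogonal_below[OF assms(1,2) u.kernel_below])
  also have "v (Q n $ i * P n $ j) = v (P n $ i * P n $ j) - lam / \<Lambda> n * ?p * v (?K * P n $ j)"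
    using assms(2) by (subst Q_def) (simp add: v.diff_scale_mult_left)
  also have "v (?K * P n $ j) = (\<Lambda> n - 1) * ?q"
    using assms(3) by (simp add: v_eq u.kernel_P eval_poly_mult \<Lambda>_def)
  also have "v (P n $ i * P n $ j) = u (P n $ i * P n $ j) + lam * ?p * ?q"
    by (simp add: v_eq eval_poly_mult)
  finally show ?thesis
    using assms(1) by (simp add: field_simps)
qed

lemma orthogonal_seq_Q:
  assumes "\<And>n. \<Lambda> n \<noteq> 0"
  shows "orthogonal_seq v Q"
  unfolding orthogonal_seq_def
proof (intro conjI allI impI)
  fix n
  show "Q n \<in> carrier_vec (rdim CARD('d) n)" by (rule carrier_vecI) (simp only: dim_Q u.dim_P)
  show "set\<^sub>v (Q n) \<subseteq> polys_upto n"
    unfolding vec_set_def polys_upto_eq_below using Q_below by auto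
next
  fix n m :: nat assume "n \<noteq> m"
  have "v (Q n $ i * Q m $ j) = 0" if "i < u.r n" "j < u.r m" for i j
  proof (cases "n < m")
    case True
    then have "Q n $ i \<in> polys_below m"
      using Q_below[OF that(1)] polys_below_mono[of "Suc n" m] by auto
    from Q_orthogonal_below[OF assms that(2) this] show ?thesis by (simp add: mult.commute)
  next
    case False
    with \<open>n \<noteq> m\<close> have "Q m $ j \<in> polys_below n"
      using Q_below[OF that(2)] polys_below_mono[of "Suc m" n] by auto
    from Q_orthogonal_below[OF assms that(1) this] show ?thesis .
  qed
  then show "moment_matrix v (Q n) (Q m) = 0\<^sub>m (rdim CARD('d) n) (rdim CARD('d) m)"
    unfolding u.dim_P[symmetric] by (intro eq_matI) (simp_all add: moment_matrix_def)
next
  fix n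
  let ?a = "eval_vec (P n) c"
  have a: "?a \<in> carrier_vec (u.r n)" by (rule carrier_vecI) (simp add: eval_vec_def)
  \<comment> \<open>The quadratic form in the rank-one criterion is the diagonal increment of the kernel.\<close>
  have "\<Lambda> (Suc n) = \<Lambda> n + lam * (?a \<bullet> (u.G n *\<^sub>v ?a))"
    by (simp add: \<Lambda>_def u.kernel_Suc_diag distrib_left)
  then have "1 + lam / \<Lambda> n * (?a \<bullet> (u.G n *\<^sub>v ?a)) = \<Lambda> (Suc n) / \<Lambda> n"
    using assms[of n] by (simp add: field_simps)
  then have nz: "1 + lam / \<Lambda> n * (?a \<bullet> (u.G n *\<^sub>v ?a)) \<noteq> 0"
    using assms[of n] assms[of "Suc n"] by (metis divide_eq_0_iff)
  show "invertible_mat (moment_matrix v (Q n) (Q n))"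
    by (rule invertible_rank_one_update[OF u.H_carrier u.G_inverse(2,1) a nz])
      (simp_all add: moment_matrix_def Q_norm assms eval_vec_def)
qed

lemma quasi_definite_iff: "quasi_definite v \<longleftrightarrow> (\<forall>n. \<Lambda> (Suc n) \<noteq> 0)"
proof
  assume "\<forall>n. \<Lambda> (Suc n) \<noteq> 0"
  then have "\<Lambda> n \<noteq> 0" for n by (cases n) (simp_all add: \<Lambda>_0)
  then show "quasi_definite v" using orthogonal_seq_Q by (auto simp: quasi_definite_def)
qed (auto simp: quasi_definite_def \<Lambda>_nonzero)

end

theorem theorem4:
  fixes u v :: "('d::finite) poly_d \<Rightarrow> real"
    and lam :: real and c :: "real^'d"
    and P :: "nat \<Rightarrow> 'd poly_d Matrix.vec"
  assumes "moment_functional u" and "positive_definite u"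
    and "lam \<noteq> 0"
    and "\<And>p. v p = u p + lam * eval_poly p c"
    and "orthogonal_seq u P"
  shows "(quasi_definite v \<longleftrightarrow> (\<forall>n::nat. mass_const u P lam c (int n) \<noteq> 0)) \<and>
    (quasi_definite v \<longrightarrow>
      (\<forall>Q. orthogonal_seq v Q \<longrightarrow>
        (\<forall>(k::nat) (x::real^'d) (y::real^'d).
          kernelP v Q k x y =
            kernelP u P k x y
            - lam / mass_const u P lam c (int k)
                * kernelK u P (int k) x c * kernelK u P (int k) c y
            + lam / mass_const u P lam c (int k - 1)
                * kernelK u P (int k - 1) x c * kernelK u P (int k - 1) c y) \<and>
        (\<forall>(n::nat) (x::real^'d) (y::real^'d).
          kernelK v Q (int n) x y =
            kernelK u P (int n) x y
            - lam / mass_const u P lam c (int n)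
                * kernelK u P (int n) x c * kernelK u P (int n) c y)))"
proof -
  interpret point_mass u P v lam c
    by unfold_locales (use assms in auto)
  have mass: "mass_const u P lam c (int n) = \<Lambda> (Suc n)" for n
    using mass_const_eq[of "Suc n"] by simp
  have K: "kernelK u P (int n) x y = eval_poly (u.kernel (Suc n) x) y" for n x y
    using u.kernelK_eq[of "Suc n"] by simp
  show ?thesis
  proof (intro conjI impI allI)
    show "quasi_definite v \<longleftrightarrow> (\<forall>n::nat. mass_const u P lam c (int n) \<noteq> 0)"
      by (simp add: quasi_definite_iff mass)
  next
    fix Q k and x y :: "real^'d" assume Q: "orthogonal_seq v Q"
    interpret Q: orthogonal_system v Q by unfold_locales (rule Q)
    show "kernelP v Q k x y =
            kernelP u P k x y
            - lam / mass_const u P lam c (int k)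
                * kernelK u P (int k) x c * kernelK u P (int k) c y
            + lam / mass_const u P lam c (int k - 1)
                * kernelK u P (int k - 1) x c * kernelK u P (int k - 1) c y"
      by (simp add: Q.kernelP_eq_diff u.kernelP_eq_diff kernel_perturbed[OF Q] mass K
          mass_const_eq u.kernelK_eq)
  next
    fix Q n and x y :: "real^'d" assume Q: "orthogonal_seq v Q"
    interpret Q: orthogonal_system v Q by unfold_locales (rule Q)
    show "kernelK v Q (int n) x y =
            kernelK u P (int n) x y
            - lam / mass_const u P lam c (int n)
                * kernelK u P (int n) x c * kernelK u P (int n) c y"
      using Q.kernelK_eq[of "Suc n" x y] by (simp add: K kernel_perturbed[OF Q] mass)
  qed
qed

end
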